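(* Let $n \ge 1$ and let $S \subset \mathbb{R}^n$ be a well-centered convex body, meaning that $S$ is a compact convex set with non-empty interior and that there exists an ellipsoid $E$ centered at the origin such that $E \subset S \subset nE$. Fix real numbers $s, s_0$ with $0 \le s \le s_0 < 1$. Then for each $y \in (1-s)\,\partial S$ there exists a hyperplane $P$ supporting $S$ such that $$\operatorname{dist}(y, P) \;\le\; c(n,s_0)\, s^{1/2^{n-1}}\, \operatorname{diam}(P^\perp \cap S),$$ where $P^\perp$ denotes the unique line through the origin orthogonal to $P$, and $$c(n,s_0) = n^{3/2}\Big(n-\tfrac{1}{2}\Big)\left(\frac{1+(s_0)^{1/2^n}}{1-(s_0)^{1/2^n}}\right)^{n-1}.$$
   Context: All distances, diameters and orthogonality are with respect to the standard Euclidean inner product on $\mathbb{R}^n$. For $\lambda \ge 0$ and $A \subset \mathbb{R}^n$, $\lambda A = \{\lambda a : a \in A\}$ is the dilation with respect to the origin; thus $(1-s)\,\partial S$ is the dilate by factor $1-s$ of the boundary $\partial S$, and $nE$ is the dilate of $E$ by factor $n$. An ellipsoid centered at the origin is the image of the closed Euclidean unit ball under an invertible linear map. A hyperplane $P \subset \mathbb{R}^n$ is an affine subspace of dimension $n-1$ (not necessarily through the origin; a single point if $n=1$). It supports $S$ if $P \cap S \neq \emptyset$ and $S$ is contained in one of the two closed half-spaces bounded by $P$. Here $\operatorname{dist}(y,P) = \inf_{p \in P} |y-p|$. *)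

theory Defs
  imports "HOL-Analysis.Analysis"
begin

definition centered_ellipsoid :: "(real ^ 'n) set \<Rightarrow> bool" where
  "centered_ellipsoid E \<longleftrightarrow>
     (\<exists>f :: real ^ 'n \<Rightarrow> real ^ 'n. linear f \<and> bij f \<and> E = f ` cball 0 1)"

definition convex_body :: "(real ^ 'n) set \<Rightarrow> bool" where
  "convex_body S \<longleftrightarrow> compact S \<and> convex S \<and> interior S \<noteq> {}"

definition dilate :: "real \<Rightarrow> (real ^ 'n) set \<Rightarrow> (real ^ 'n) set" where
  "dilate t A = (\<lambda>a. t *\<^sub>R a) ` A"

text \<open>Inclusions are not required to be strict; for \<open>CARD('n) = 1\<close> both are equalities.\<close>

definition well_centered :: "(real ^ 'n) set \<Rightarrow> bool" where
  "well_centered S \<longleftrightarrow>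
     convex_body S \<and>
     (\<exists>E. centered_ellipsoid E \<and> E \<subseteq> S \<and> S \<subseteq> dilate (real CARD('n)) E)"

definition hyperplane :: "(real ^ 'n) set \<Rightarrow> bool" where
  "hyperplane P \<longleftrightarrow> affine P \<and> aff_dim P = int CARD('n) - 1"

text \<open>Replacing \<open>(a, b)\<close> by \<open>(-a, -b)\<close> exchanges the two closed half-spaces bounded
  by \<open>P\<close>, so one inequality covers both.\<close>

definition supporting_hyperplane :: "(real ^ 'n) set \<Rightarrow> (real ^ 'n) set \<Rightarrow> bool" where
  "supporting_hyperplane P S \<longleftrightarrow>
     hyperplane P \<and> P \<inter> S \<noteq> {} \<and>
     (\<exists>a b. a \<noteq> 0 \<and> P = {x. a \<bullet> x = b} \<and> S \<subseteq> {x. a \<bullet> x \<le> b})"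

text \<open>Orthogonality is to the directions \<open>p - q\<close> of \<open>P\<close>, not to its points: \<open>P\<close> need not
  contain the origin. For a hyperplane this is a line through \<open>0\<close>, also when \<open>P\<close> is a
  single point in dimension one.\<close>

definition normal_line :: "(real ^ 'n) set \<Rightarrow> (real ^ 'n) set" where
  "normal_line P = {v. \<forall>p\<in>P. \<forall>q\<in>P. v \<bullet> (p - q) = 0}"

definition c_const :: "nat \<Rightarrow> real \<Rightarrow> real" where
  "c_const n s0 =
     real n powr (3 / 2) * (real n - 1 / 2) *
     ((1 + s0 powr (1 / 2 ^ n)) / (1 - s0 powr (1 / 2 ^ n))) ^ (n - 1)"

end

theory Submission
  imports Defs
begin

text \<open>
  Write \<open>y = (1 - s) x\<close> with \<open>x\<close> on the boundary, let \<open>E = f(B)\<close> be the ellipsoid, where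
  \<open>B\<close> is the closed unit ball, and let \<open>u\<close> be an outer normal of \<open>S\<close> at \<open>x\<close>. The supporting
  hyperplane at \<open>x\<close> lies close to \<open>y\<close>, but if \<open>S\<close> is very eccentric then the line through
  \<open>0\<close> in direction \<open>u\<close> may meet \<open>S\<close> in a segment that is short even compared with this
  distance. The remedy is to tilt \<open>u\<close>, discarding its components along the short axes of \<open>E\<close>.

  Let \<open>e\<^sub>0, e\<^sub>1, \<dots>\<close> be the orthonormal principal axes of \<open>E\<close>, with half-lengths
  \<open>a\<^sub>0 \<ge> a\<^sub>1 \<ge> \<dots>\<close>, and put \<open>m\<^sub>i = a\<^sub>i \<bar>u \<bullet> e\<^sub>i\<bar>\<close>. For an index \<open>k\<close> let \<open>v\<close> be the
  projection of \<open>u\<close> to the span of \<open>e\<^sub>0, \<dots>, e\<^sub>k\<close> and \<open>w = u - v\<close>. Three estimates matter.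
  \<^item> In direction \<open>v\<close> the body is long: its central section by the span of \<open>e\<^sub>0, \<dots>, e\<^sub>k\<close> contains
    a ball of radius \<open>a\<^sub>k\<close>, so the diameter in the theorem is at least \<open>2 a\<^sub>k\<close>.
  \<^item> Since \<open>u\<close> is maximal at \<open>x\<close>, the functional \<open>v = u - w\<close> exceeds its value at \<open>x\<close> on \<open>S\<close>
    by at most the oscillation of \<open>w\<close> on \<open>S \<subseteq> n E\<close>, which is at most \<open>2 n (\<Sum>i>k. m\<^sub>i)\<close>.
  \<^item> Passing from \<open>x\<close> to \<open>y\<close> costs \<open>s (v \<bullet> x) \<le> s n (\<Sum>i\<le>k. m\<^sub>i)\<close>.

  With \<open>\<sigma> = s powr (1 / 2 ^ (n - 1))\<close> it therefore suffices to find \<open>k\<close> such that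
  \<open>m\<^sub>i \<le> \<sigma> m\<^sub>k\<close> for \<open>i > k\<close> and \<open>s m\<^sub>i \<le> \<sigma> m\<^sub>k\<close> for \<open>i \<le> k\<close>: the gap is then at most
  \<open>n (2 (n - k - 1) + (k + 1)) \<sigma> m\<^sub>k \<le> n (2 n - 1) \<sigma> m\<^sub>k\<close>, and \<open>m\<^sub>k \<le> a\<^sub>k \<bar>v\<bar>\<close>. Because
  \<open>n \<le> 2 ^ (n - 1)\<close>, one has \<open>s \<le> \<sigma> ^ n\<close>, and an index that maximises \<open>m\<^sub>k / \<sigma> ^ k\<close> does it
  (\<open>geometric_selection\<close>). The tilting argument itself is \<open>good_direction_exists\<close>; the axes
  come from \<open>singular_vectors_exist\<close>, applied to the adjoint of \<open>f\<close>.
\<close>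

section \<open>Principal axes of an ellipsoid\<close>

lemma zero_of_linear_le_quadratic:
  fixes p q :: real
  assumes "\<And>t. t * p \<le> t\<^sup>2 * q"
  shows "p = 0"
proof (rule ccontr)
  assume "p \<noteq> 0"
  define t where "t = p / (\<bar>q\<bar> + 1)"
  have tp: "p = t * (\<bar>q\<bar> + 1)" unfolding t_def by (simp add: field_simps)
  have "t \<noteq> 0" using \<open>p \<noteq> 0\<close> tp by auto
  hence "t\<^sup>2 > 0" by simp
  have "t\<^sup>2 * (\<bar>q\<bar> + 1) \<le> t\<^sup>2 * q" using assms[of t] tp by (simp add: power2_eq_square mult.assoc)
  hence "\<bar>q\<bar> + 1 \<le> q" using \<open>t\<^sup>2 > 0\<close> by (simp only: mult_le_cancel_left_pos)
  thus False by linarith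
qed

text \<open>
  The first-order condition at a maximiser: perturbing \<open>e\<close> to \<open>e + t v\<close> changes
  \<open>\<bar>g e\<bar>\<^sup>2 \<bar>\<cdot>\<bar>\<^sup>2 - \<bar>g \<cdot>\<bar>\<^sup>2\<close> by \<open>-2 t (g e \<bullet> g v)\<close> to first order, while this form stays
  nonnegative on \<open>W\<close> and vanishes at \<open>e\<close>.
\<close>

lemma max_stretched_orthogonal:
  fixes g :: "'a::euclidean_space \<Rightarrow> 'b::euclidean_space"
  assumes g: "linear g" and W: "subspace W" and e: "e \<in> W" "norm e = 1"
    and mx: "\<And>v. v \<in> W \<Longrightarrow> norm (g v) \<le> norm (g e) * norm v"
    and v: "v \<in> W" "e \<bullet> v = 0"
  shows "g e \<bullet> g v = 0"
proof -
  have "t * (2 * (g e \<bullet> g v)) \<le> t\<^sup>2 * ((norm (g e))\<^sup>2 * (norm v)\<^sup>2 - (norm (g v))\<^sup>2)" for t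
  proof -
    have "e + t *\<^sub>R v \<in> W" using W e v by (simp add: subspace_add subspace_scale)
    hence "(norm (g (e + t *\<^sub>R v)))\<^sup>2 \<le> (norm (g e) * norm (e + t *\<^sub>R v))\<^sup>2"
      by (intro power_mono mx) auto
    moreover have "(norm (e + t *\<^sub>R v))\<^sup>2 = 1 + t\<^sup>2 * (norm v)\<^sup>2"
      using e(2) v(2) unfolding power2_norm_eq_inner norm_eq_1
      by (simp add: inner_add_left inner_add_right inner_commute power2_eq_square)
    moreover have "(norm (g (e + t *\<^sub>R v)))\<^sup>2 =
        (norm (g e))\<^sup>2 + t * (2 * (g e \<bullet> g v)) + t\<^sup>2 * (norm (g v))\<^sup>2"
      unfolding power2_norm_eq_inner
      by (simp add: linear_add[OF g] linear_scale[OF g] inner_add_left inner_add_right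
          inner_commute power2_eq_square)
    ultimately show ?thesis by (simp add: power_mult_distrib algebra_simps)
  qed
  from zero_of_linear_le_quadratic[OF this] show ?thesis by simp
qed

text \<open>
  A singular value decomposition by greedy choice: each \<open>e i\<close> is a unit vector that \<open>g\<close>
  stretches most among those orthogonal to its predecessors. The stretching factors decrease
  because the competition shrinks, and the first-order condition makes the images orthogonal.
\<close>

lemma singular_vectors_exist:
  fixes g :: "'a::euclidean_space \<Rightarrow> 'b::euclidean_space"
  assumes g: "linear g"
  shows "\<exists>e :: nat \<Rightarrow> 'a. \<forall>i<DIM('a). norm (e i) = 1 \<and>
           (\<forall>j<i. e j \<bullet> e i = 0 \<and> g (e j) \<bullet> g (e i) = 0 \<and> norm (g (e i)) \<le> norm (g (e j)))"
proof -
  have "k \<le> DIM('a) \<Longrightarrow> \<exists>e :: nat \<Rightarrow> 'a. \<forall>i<k. norm (e i) = 1 \<and> (\<forall>j<i. e j \<bullet> e i = 0) \<and>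
      (\<forall>v. (\<forall>j<i. e j \<bullet> v = 0) \<longrightarrow> norm (g v) \<le> norm (g (e i)) * norm v)" for k
  proof (induction k)
    case 0 show ?case by simp
  next
    case (Suc k)
    then obtain e :: "nat \<Rightarrow> 'a" where e: "\<And>i. i < k \<Longrightarrow> norm (e i) = 1 \<and> (\<forall>j<i. e j \<bullet> e i = 0) \<and>
      (\<forall>v. (\<forall>j<i. e j \<bullet> v = 0) \<longrightarrow> norm (g v) \<le> norm (g (e i)) * norm v)" by auto
    define W where "W = {v. \<forall>j<k. e j \<bullet> v = 0}"
    have W: "subspace W" unfolding W_def subspace_def by (auto simp: inner_add_right)
    have "dim (span (e ` {..<k})) \<le> k"
      using dim_le_card'[of "e ` {..<k}"] card_image_le[of "{..<k}" e] by simp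
    hence "dim (e ` {..<k}) < DIM('a)" using Suc.prems by simp
    then obtain w where w: "w \<noteq> 0" "\<And>y. y \<in> span (e ` {..<k}) \<Longrightarrow> orthogonal w y"
      using orthogonal_to_subspace_exists by blast
    have "w \<in> W" unfolding W_def using w(2)
      by (auto simp: orthogonal_def inner_commute[of _ w] intro: span_base)
    hence ne: "w /\<^sub>R norm w \<in> W \<inter> sphere 0 1" using w(1) W by (auto simp: subspace_scale)
    have "compact (W \<inter> sphere 0 1)"
      using closed_subspace[OF W] by (intro closed_Int_compact) auto
    moreover have "continuous_on (W \<inter> sphere 0 1) (\<lambda>v. norm (g v))"
      using g by (intro continuous_on_norm linear_continuous_on linear_conv_bounded_linear[THEN iffD1])
    ultimately obtain x where "x \<in> W \<inter> sphere 0 1"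
      and "\<forall>v \<in> W \<inter> sphere 0 1. norm (g v) \<le> norm (g x)"
      using continuous_attains_sup[of "W \<inter> sphere 0 1" "\<lambda>v. norm (g v)"] ne by blast
    hence x: "x \<in> W" "norm x = 1"
      and mx: "\<And>v. v \<in> W \<Longrightarrow> norm v = 1 \<Longrightarrow> norm (g v) \<le> norm (g x)"
      by auto
    have mx': "norm (g v) \<le> norm (g x) * norm v" if "v \<in> W" for v
    proof (cases "v = 0")
      case True then show ?thesis by (simp add: linear_0[OF g])
    next
      case False
      have "norm (g (v /\<^sub>R norm v)) \<le> norm (g x)"
        using that False W by (intro mx) (auto simp: subspace_scale)
      thus ?thesis using False by (simp add: linear_scale[OF g] field_simps)
    qed
    define e' where "e' = e(k := x)"
    have old: "e' i = e i" if "i < k" for i using that by (simp add: e'_def)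
    have new: "e' k = x" by (simp add: e'_def)
    have "norm (e' i) = 1 \<and> (\<forall>j<i. e' j \<bullet> e' i = 0) \<and>
      (\<forall>v. (\<forall>j<i. e' j \<bullet> v = 0) \<longrightarrow> norm (g v) \<le> norm (g (e' i)) * norm v)" if "i < Suc k" for i
    proof (cases "i = k")
      case True
      then show ?thesis using x mx' by (auto simp: old new W_def)
    next
      case False
      hence "i < k" using that by simp
      then show ?thesis using e[of i] by (simp add: old)
    qed
    thus ?case by blast
  qed
  from this[of "DIM('a)"] obtain e :: "nat \<Rightarrow> 'a" where
    "\<forall>i<DIM('a). norm (e i) = 1 \<and> (\<forall>j<i. e j \<bullet> e i = 0) \<and>
      (\<forall>v. (\<forall>j<i. e j \<bullet> v = 0) \<longrightarrow> norm (g v) \<le> norm (g (e i)) * norm v)" by blast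
  hence e: "\<And>i. i < DIM('a) \<Longrightarrow> norm (e i) = 1 \<and> (\<forall>j<i. e j \<bullet> e i = 0)"
    and mx: "\<And>i v. i < DIM('a) \<Longrightarrow> (\<forall>j<i. e j \<bullet> v = 0) \<Longrightarrow> norm (g v) \<le> norm (g (e i)) * norm v"
    by blast+
  have "g (e j) \<bullet> g (e i) = 0 \<and> norm (g (e i)) \<le> norm (g (e j))" if "i < DIM('a)" "j < i" for i j
  proof
    have j: "j < DIM('a)" using that by simp
    have W: "subspace {v. \<forall>l<j. e l \<bullet> v = 0}" unfolding subspace_def by (auto simp: inner_add_right)
    show "g (e j) \<bullet> g (e i) = 0"
      using e[OF j] e[OF that(1)] that
      by (intro max_stretched_orthogonal[OF g W]) (auto intro!: mx[OF j])
    show "norm (g (e i)) \<le> norm (g (e j))"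
      using mx[OF j, of "e i"] e[OF that(1)] that by auto
  qed
  with e show ?thesis by blast
qed

lemma orthonormal_sequence_expand:
  fixes e :: "nat \<Rightarrow> 'a::euclidean_space"
  assumes e: "\<And>i. i < DIM('a) \<Longrightarrow> norm (e i) = 1"
    and o: "\<And>i j. i < DIM('a) \<Longrightarrow> j < DIM('a) \<Longrightarrow> i \<noteq> j \<Longrightarrow> e i \<bullet> e j = 0"
  shows "(\<Sum>i<DIM('a). (x \<bullet> e i) *\<^sub>R e i) = x"
proof -
  have inj: "inj_on e {..<DIM('a)}"
    by (rule inj_onI) (metis e o lessThan_iff inner_eq_zero_iff norm_zero zero_neq_one)
  have po: "pairwise orthogonal (e ` {..<DIM('a)})"
    using o by (auto simp: pairwise_def orthogonal_def)
  have "0 \<notin> e ` {..<DIM('a)}" using e by fastforce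
  hence ind: "independent (e ` {..<DIM('a)})" using po pairwise_orthogonal_independent by blast
  have "card (e ` {..<DIM('a)}) = DIM('a)" using inj by (simp add: card_image)
  hence "dim (e ` {..<DIM('a)}) = DIM('a)" using ind by (simp add: dim_eq_card_independent)
  hence "span (e ` {..<DIM('a)}) = UNIV" by (simp add: dim_eq_full)
  hence "(\<Sum>b\<in>e ` {..<DIM('a)}. (x \<bullet> b) *\<^sub>R b) = x"
    using e by (intro orthonormal_basis_expand[OF po]) auto
  thus ?thesis by (simp add: sum.reindex[OF inj])
qed

text \<open>
  If \<open>e\<close> is orthonormal with orthogonal images under the adjoint \<open>g\<close> of \<open>f\<close>, then
  \<open>f (g (e i)) = \<bar>g (e i)\<bar>\<^sup>2 e i\<close>. Hence the \<open>e i\<close> are the principal axes of \<open>f ` cball 0 1\<close>,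
  with half-lengths \<open>\<bar>g (e i)\<bar>\<close>, and a preimage of a combination of the first few axes can be
  written down explicitly; its norm is given by Pythagoras.
\<close>

lemma ellipsoid_contains_flag_ball:
  fixes f :: "'a::euclidean_space \<Rightarrow> 'a" and e :: "nat \<Rightarrow> 'a"
  assumes f: "linear f"
    and e: "\<And>i. i < DIM('a) \<Longrightarrow> norm (e i) = 1"
    and o: "\<And>i j. i < DIM('a) \<Longrightarrow> j < DIM('a) \<Longrightarrow> i \<noteq> j \<Longrightarrow> e i \<bullet> e j = 0"
    and go: "\<And>i j. i < DIM('a) \<Longrightarrow> j < DIM('a) \<Longrightarrow> i \<noteq> j \<Longrightarrow> adjoint f (e i) \<bullet> adjoint f (e j) = 0"
    and k: "k < DIM('a)" and pos: "0 < r"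
    and large: "\<And>i. i \<le> k \<Longrightarrow> r \<le> norm (adjoint f (e i))"
    and small: "norm (\<Sum>i\<le>k. c i *\<^sub>R e i) \<le> r"
  shows "(\<Sum>i\<le>k. c i *\<^sub>R e i) \<in> f ` cball 0 1"
proof -
  define a where "a i = norm (adjoint f (e i))" for i
  have apos: "0 < a i" "r \<le> a i" if "i \<le> k" for i using large[OF that] pos by (auto simp: a_def)
  have fg: "f (adjoint f (e i)) = (a i)\<^sup>2 *\<^sub>R e i" if "i < DIM('a)" for i
  proof -
    have "f (adjoint f (e i)) = (\<Sum>j<DIM('a). (f (adjoint f (e i)) \<bullet> e j) *\<^sub>R e j)"
      by (rule orthonormal_sequence_expand[OF e o, symmetric])
    also have "\<dots> = (\<Sum>j<DIM('a). if j = i then (a i)\<^sup>2 *\<^sub>R e i else 0)"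
      using that go by (intro sum.cong)
        (auto simp: adjoint_works[OF f, symmetric] a_def power2_norm_eq_inner)
    finally show ?thesis using that by simp
  qed
  define p where "p = (\<Sum>i\<le>k. (c i / (a i)\<^sup>2) *\<^sub>R adjoint f (e i))"
  have "f p = (\<Sum>i\<le>k. (c i / (a i)\<^sup>2) *\<^sub>R (a i)\<^sup>2 *\<^sub>R e i)"
    unfolding p_def using k by (simp add: linear_sum[OF f] linear_scale[OF f] fg)
  also have "\<dots> = (\<Sum>i\<le>k. c i *\<^sub>R e i)" using apos by (intro sum.cong) force+
  finally have fp: "f p = (\<Sum>i\<le>k. c i *\<^sub>R e i)" .
  have "(norm p)\<^sup>2 = (\<Sum>i\<le>k. (norm ((c i / (a i)\<^sup>2) *\<^sub>R adjoint f (e i)))\<^sup>2)"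
    unfolding p_def using go k
    by (intro norm_sum_Pythagorean) (auto simp: pairwise_def orthogonal_def)
  also have "\<dots> = (\<Sum>i\<le>k. (c i)\<^sup>2 / (a i)\<^sup>2)"
  proof (rule sum.cong)
    fix i assume "i \<in> {..k}"
    hence "a i \<noteq> 0" using apos[of i] by auto
    thus "(norm ((c i / (a i)\<^sup>2) *\<^sub>R adjoint f (e i)))\<^sup>2 = (c i)\<^sup>2 / (a i)\<^sup>2"
      by (simp add: a_def[symmetric] power_mult_distrib power_divide power2_eq_square)
  qed simp
  also have "\<dots> \<le> (\<Sum>i\<le>k. (c i)\<^sup>2 / r\<^sup>2)"
  proof (rule sum_mono)
    fix i assume "i \<in> {..k}"
    hence "r\<^sup>2 \<le> (a i)\<^sup>2" "0 < a i" using apos[of i] pos by (auto intro: power_mono)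
    thus "(c i)\<^sup>2 / (a i)\<^sup>2 \<le> (c i)\<^sup>2 / r\<^sup>2" using pos by (intro divide_left_mono) auto
  qed
  also have "\<dots> = (\<Sum>i\<le>k. (norm (c i *\<^sub>R e i))\<^sup>2) / r\<^sup>2"
    using e k by (simp add: sum_divide_distrib)
  also have "(\<Sum>i\<le>k. (norm (c i *\<^sub>R e i))\<^sup>2) = (norm (\<Sum>i\<le>k. c i *\<^sub>R e i))\<^sup>2"
    using o k by (intro norm_sum_Pythagorean[symmetric]) (auto simp: pairwise_def orthogonal_def)
  also have "\<dots> / r\<^sup>2 \<le> 1" using small pos by (simp add: power_mono)
  finally have "norm p \<le> 1" by (simp add: abs_square_le_1)
  thus ?thesis using fp by (intro image_eqI[of _ _ p]) auto
qed

text \<open>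
  The norm of \<open>adjoint f w\<close> is the value at \<open>w\<close> of the support function of \<open>f ` cball 0 1\<close>.
\<close>

lemma abs_inner_dilated_ellipsoid_le:
  fixes f :: "'a::euclidean_space \<Rightarrow> 'b::euclidean_space"
  assumes f: "linear f" and "0 \<le> t" and z: "z \<in> (\<lambda>a. t *\<^sub>R a) ` f ` cball 0 1"
  shows "\<bar>w \<bullet> z\<bar> \<le> t * norm (adjoint f w)"
proof -
  obtain c where c: "z = t *\<^sub>R f c" "norm c \<le> 1" using z unfolding image_iff by force
  have "w \<bullet> z = t * (adjoint f w \<bullet> c)" by (simp add: c adjoint_clauses(2)[OF f])
  moreover have "\<bar>adjoint f w \<bullet> c\<bar> \<le> norm (adjoint f w) * 1"
    using Cauchy_Schwarz_ineq2[of "adjoint f w" c] c(2)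
    by (meson mult_left_mono norm_ge_zero order_trans)
  ultimately show ?thesis using \<open>0 \<le> t\<close> by (simp add: abs_mult mult_left_mono)
qed

section \<open>Tilting the normal vector\<close>

text \<open>
  A maximiser \<open>k\<close> of \<open>m k / \<sigma> ^ k\<close> satisfies \<open>m i \<le> \<sigma> ^ i / \<sigma> ^ k * m k\<close> for all \<open>i\<close>. For \<open>i > k\<close>
  the exponent \<open>i - k\<close> is at least \<open>1\<close>; for \<open>i \<le> k\<close>, after multiplication by \<open>\<sigma> ^ n\<close>, the
  exponent \<open>n + i - k\<close> is still at least \<open>1\<close> because \<open>k < n\<close>.
\<close>

lemma geometric_selection:
  fixes m :: "nat \<Rightarrow> real"
  assumes pos: "\<exists>i<n. 0 < m i" and \<sigma>: "0 < \<sigma>" "\<sigma> \<le> 1"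
  shows "\<exists>k<n. 0 < m k \<and> (\<forall>i. k < i \<and> i < n \<longrightarrow> m i \<le> \<sigma> * m k) \<and> (\<forall>i\<le>k. \<sigma> ^ n * m i \<le> \<sigma> * m k)"
proof -
  define M where "M = Max ((\<lambda>i. m i / \<sigma> ^ i) ` {..<n})"
  have fin: "finite ((\<lambda>i. m i / \<sigma> ^ i) ` {..<n})" by simp
  have "M \<in> (\<lambda>i. m i / \<sigma> ^ i) ` {..<n}" unfolding M_def using pos by (intro Max_in) auto
  then obtain k where k: "k < n" "M = m k / \<sigma> ^ k" by auto
  have mx: "m i \<le> \<sigma> ^ i * (m k / \<sigma> ^ k)" if "i < n" for i
  proof -
    have "m i / \<sigma> ^ i \<le> M" unfolding M_def using that by (intro Max_ge[OF fin]) auto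
    thus ?thesis using \<sigma> by (simp add: k field_simps)
  qed
  have "0 < m k"
  proof -
    obtain i where "i < n" "0 < m i" using pos by auto
    hence "0 < \<sigma> ^ i * (m k / \<sigma> ^ k)" using mx[of i] by linarith
    thus ?thesis using \<sigma> by (simp add: zero_less_mult_iff zero_less_divide_iff)
  qed
  moreover have "m i \<le> \<sigma> * m k" if "k < i" "i < n" for i
  proof -
    have "\<sigma> ^ i \<le> \<sigma> ^ Suc k" using that \<sigma> by (intro power_decreasing) auto
    hence "\<sigma> ^ i * (m k / \<sigma> ^ k) \<le> \<sigma> ^ Suc k * (m k / \<sigma> ^ k)"
      using \<open>0 < m k\<close> \<sigma> by (intro mult_right_mono) auto
    also have "\<dots> = \<sigma> * m k" using \<sigma> by simp
    finally show ?thesis using mx[OF that(2)] by linarith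
  qed
  moreover have "\<sigma> ^ n * m i \<le> \<sigma> * m k" if "i \<le> k" for i
  proof -
    have "\<sigma> ^ n * m i \<le> \<sigma> ^ n * (\<sigma> ^ i * (m k / \<sigma> ^ k))"
      using mx[of i] that k(1) \<sigma> by (intro mult_left_mono) auto
    also have "\<dots> = \<sigma> ^ (n + i) * (m k / \<sigma> ^ k)" by (simp add: power_add)
    also have "\<dots> \<le> \<sigma> ^ Suc k * (m k / \<sigma> ^ k)"
      using k(1) \<sigma> \<open>0 < m k\<close> by (intro mult_right_mono power_decreasing) auto
    also have "\<dots> = \<sigma> * m k" using \<sigma> by simp
    finally show ?thesis .
  qed
  ultimately show ?thesis using k(1) by blast
qed

text \<open>
  The normal \<open>u\<close> at \<open>x\<close> is replaced by its projection \<open>v\<close> to the span of the longest axes, cut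
  after the selected index \<open>k\<close>; then \<open>r\<close> is the half-length of the axis \<open>k\<close>. The left-hand side of
  the last inequality is \<open>\<bar>v\<bar>\<close> times the signed distance of \<open>(1 - s) x\<close> from the hyperplane
  normal to \<open>v\<close> through \<open>z\<close>.
\<close>

lemma good_direction_exists:
  fixes f :: "'a::euclidean_space \<Rightarrow> 'a"
  assumes f: "linear f" "bij f"
    and SE: "S \<subseteq> (\<lambda>a. real DIM('a) *\<^sub>R a) ` f ` cball 0 1"
    and x: "x \<in> S" and u: "u \<noteq> 0" and supp: "\<And>z. z \<in> S \<Longrightarrow> u \<bullet> z \<le> u \<bullet> x"
    and \<sigma>: "0 < \<sigma>" "\<sigma> \<le> 1" and s: "0 \<le> s" "s \<le> \<sigma> ^ DIM('a)"
  shows "\<exists>v r. v \<noteq> 0 \<and> 0 < r \<and> (r / norm v) *\<^sub>R v \<in> f ` cball 0 1 \<and>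
           (\<forall>z\<in>S. v \<bullet> z - (1 - s) * (v \<bullet> x)
              \<le> real DIM('a) * (2 * real DIM('a) - 1) * \<sigma> * r * norm v)"
proof -
  define n where "n = DIM('a)"
  define g where "g = adjoint f"
  have g: "linear g" unfolding g_def by (rule adjoint_linear[OF f(1)])
  have gnz: "g y \<noteq> 0" if "y \<noteq> 0" for y
  proof
    assume "g y = 0"
    obtain p where "y = f p" using f(2) by (metis bij_pointE)
    hence "y \<bullet> y = p \<bullet> g y" by (simp add: g_def adjoint_works[OF f(1)])
    thus False using \<open>g y = 0\<close> that by simp
  qed
  obtain e :: "nat \<Rightarrow> 'a" where "\<forall>i<DIM('a). norm (e i) = 1 \<and>
      (\<forall>j<i. e j \<bullet> e i = 0 \<and> g (e j) \<bullet> g (e i) = 0 \<and> norm (g (e i)) \<le> norm (g (e j)))"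
    using singular_vectors_exist[OF g] by blast
  hence e: "\<And>i. i < n \<Longrightarrow> norm (e i) = 1"
    and lower: "\<And>i j. i < n \<Longrightarrow> j < i \<Longrightarrow>
        e j \<bullet> e i = 0 \<and> g (e j) \<bullet> g (e i) = 0 \<and> norm (g (e i)) \<le> norm (g (e j))"
    by (auto simp: n_def)
  have o: "e i \<bullet> e j = 0" "g (e i) \<bullet> g (e j) = 0" if "i < n" "j < n" "i \<noteq> j" for i j
    using lower[of i j] lower[of j i] that by (auto simp: inner_commute dest: nat_neq_iff[THEN iffD1])
  define a where "a i = norm (g (e i))" for i
  have a_pos: "0 < a i" if "i < n" for i
    using e[OF that] gnz[of "e i"] unfolding a_def zero_less_norm_iff
    by (metis norm_zero zero_neq_one)
  have a_le: "a k \<le> a i" if "i \<le> k" "k < n" for i k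
    using lower[of k i] that by (cases "i = k") (auto simp: a_def)
  define c where "c i = u \<bullet> e i" for i
  have u_eq: "(\<Sum>i<n. c i *\<^sub>R e i) = u"
    unfolding c_def n_def by (rule orthonormal_sequence_expand) (use e o in \<open>auto simp: n_def\<close>)
  define m where "m i = a i * \<bar>c i\<bar>" for i
  have "\<exists>i<n. c i \<noteq> 0" using u u_eq by (metis (no_types, lifting) lessThan_iff scaleR_eq_0_iff sum.neutral)
  hence m_pos: "\<exists>i<n. 0 < m i" using a_pos by (auto simp: m_def)
  obtain k where k: "k < n" "0 < m k"
    and above: "\<And>i. k < i \<Longrightarrow> i < n \<Longrightarrow> m i \<le> \<sigma> * m k"
    and below: "\<And>i. i \<le> k \<Longrightarrow> \<sigma> ^ n * m i \<le> \<sigma> * m k"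
    using geometric_selection[OF m_pos \<sigma>] by blast
  define v where "v = (\<Sum>i\<le>k. c i *\<^sub>R e i)"
  define w where "w = (\<Sum>i\<in>{k<..<n}. c i *\<^sub>R e i)"
  have split: "{..<n} = {..k} \<union> {k<..<n}" using k(1) by auto
  have uvw: "u = v + w"
    unfolding u_eq[symmetric] v_def w_def split by (rule sum.union_disjoint) auto
  have g_sum: "norm (g (\<Sum>i\<in>I. c i *\<^sub>R e i)) \<le> (\<Sum>i\<in>I. m i)" for I
    using norm_sum[of "\<lambda>i. c i *\<^sub>R g (e i)" I]
    by (simp add: linear_sum[OF g] linear_scale[OF g] m_def a_def mult.commute)
  have gw: "norm (g w) \<le> real (n - Suc k) * (\<sigma> * m k)"
  proof -
    have "(\<Sum>i\<in>{k<..<n}. m i) \<le> (\<Sum>i\<in>{k<..<n}. \<sigma> * m k)" using above by (intro sum_mono) auto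
    thus ?thesis using g_sum[of "{k<..<n}"] by (simp add: w_def)
  qed
  have gv: "s * norm (g v) \<le> real (Suc k) * (\<sigma> * m k)"
  proof -
    have "s * norm (g v) \<le> \<sigma> ^ n * (\<Sum>i\<le>k. m i)"
      unfolding v_def using s by (intro mult_mono g_sum) (auto simp: n_def)
    also have "\<dots> \<le> (\<Sum>i\<le>k. \<sigma> * m k)" unfolding sum_distrib_left using below by (intro sum_mono) auto
    finally show ?thesis by simp
  qed
  have "v \<bullet> e k = (\<Sum>i\<le>k. if i = k then c k else 0)"
    unfolding v_def inner_sum_left using o k(1) e[OF k(1)]
    by (intro sum.cong) (auto simp: norm_eq_1)
  hence vk: "v \<bullet> e k = c k" by simp
  have v0: "v \<noteq> 0" using vk k(2) by (auto simp: m_def)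
  have "\<bar>c k\<bar> \<le> norm v" using Cauchy_Schwarz_ineq2[of v "e k"] vk e[OF k(1)] by simp
  hence mk: "m k \<le> a k * norm v" using a_pos[OF k(1)] by (simp add: m_def)
  have sub: "(a k / norm v) *\<^sub>R v = (\<Sum>i\<le>k. (a k / norm v * c i) *\<^sub>R e i)"
    by (simp add: v_def scaleR_sum_right)
  have inE: "(a k / norm v) *\<^sub>R v \<in> f ` cball 0 1"
    unfolding sub
  proof (rule ellipsoid_contains_flag_ball[OF f(1), where r = "a k"])
    show "norm (\<Sum>i\<le>k. (a k / norm v * c i) *\<^sub>R e i) \<le> a k"
      unfolding sub[symmetric] using v0 a_pos[OF k(1)] by simp
    show "a k \<le> norm (adjoint f (e i))" if "i \<le> k" for i
      using a_le[OF that k(1)] by (simp add: a_def g_def)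
  qed (use e o k(1) a_pos in \<open>auto simp: n_def g_def\<close>)
  have width: "\<bar>p \<bullet> z\<bar> \<le> real n * norm (g p)" if "z \<in> S" for p z
    using abs_inner_dilated_ellipsoid_le[OF f(1), of "real n" z p] that SE by (auto simp: g_def n_def)
  \<comment> \<open>Triangle inequalities suffice: \<open>k + 1\<close> terms of weight one and \<open>n - k - 1\<close> of weight two add
    up to at most \<open>2 n - 1\<close>, because \<open>w\<close> has at most \<open>n - 1\<close> terms.\<close>
  have gap: "v \<bullet> z - (1 - s) * (v \<bullet> x) \<le> real n * (2 * real n - 1) * \<sigma> * a k * norm v"
    if z: "z \<in> S" for z
  proof -
    have "v \<bullet> z - (1 - s) * (v \<bullet> x) = (u \<bullet> z - u \<bullet> x) + w \<bullet> x - w \<bullet> z + s * (v \<bullet> x)"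
      by (simp add: uvw inner_add_left algebra_simps)
    also have "\<dots> \<le> 0 + real n * norm (g w) + real n * norm (g w) + s * (real n * norm (g v))"
    proof -
      have "s * (v \<bullet> x) \<le> s * (real n * norm (g v))"
        using width[OF x, of v] s(1) by (intro mult_left_mono) auto
      thus ?thesis using supp[OF z] width[OF x, of w] width[OF z, of w] by linarith
    qed
    also have "\<dots> = real n * (2 * norm (g w) + s * norm (g v))" by (simp add: algebra_simps)
    also have "\<dots> \<le> real n * ((2 * real n - 1) * (\<sigma> * (a k * norm v)))"
    proof (rule mult_left_mono)
      have "2 * norm (g w) + s * norm (g v)
          \<le> (2 * real (n - Suc k) + real (Suc k)) * (\<sigma> * m k)"
        unfolding distrib_right mult.assoc using gw gv by linarith
      also have "\<dots> \<le> (2 * real n - 1) * (\<sigma> * (a k * norm v))"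
        using k \<sigma> mk by (intro mult_mono mult_left_mono mult_nonneg_nonneg) (auto simp: of_nat_diff)
      finally show "2 * norm (g w) + s * norm (g v) \<le> (2 * real n - 1) * (\<sigma> * (a k * norm v))" .
    qed simp
    finally show ?thesis by (simp add: mult.assoc)
  qed
  show ?thesis
    using v0 a_pos[OF k(1)] inE gap unfolding n_def by blast
qed

section \<open>From the direction to the hyperplane\<close>

lemma infdist_hyperplane_le:
  fixes v :: "'a::real_inner"
  assumes "v \<noteq> 0" and "v \<bullet> y \<le> b"
  shows "infdist y {z. v \<bullet> z = b} \<le> (b - v \<bullet> y) / norm v"
proof -
  define q where "q = y + ((b - v \<bullet> y) / (v \<bullet> v)) *\<^sub>R v"
  have "q \<in> {z. v \<bullet> z = b}" using assms(1) by (simp add: q_def inner_add_right)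
  hence "infdist y {z. v \<bullet> z = b} \<le> dist y q" by (rule infdist_le)
  also have "\<dots> = (b - v \<bullet> y) / (v \<bullet> v) * norm v"
    using assms(2) by (simp add: q_def dist_norm)
  also have "\<dots> = (b - v \<bullet> y) / norm v"
    using assms(1) by (simp add: power2_norm_eq_inner[symmetric] power2_eq_square)
  finally show ?thesis .
qed

lemma supporting_hyperplane_at_maximizer:
  fixes S :: "(real ^ 'n) set"
  assumes "v \<noteq> 0" "z \<in> S" "\<And>z'. z' \<in> S \<Longrightarrow> v \<bullet> z' \<le> v \<bullet> z"
  shows "supporting_hyperplane {p. v \<bullet> p = v \<bullet> z} S"
proof -
  have "hyperplane {p. v \<bullet> p = v \<bullet> z}"
    using assms(1) by (simp add: hyperplane_def affine_hyperplane of_nat_diff Suc_le_eq)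
  thus ?thesis unfolding supporting_hyperplane_def using assms by blast
qed

text \<open>
  The left-hand side is the constant that the tilting argument yields. The power of the quotient
  in \<open>c_const\<close> has a base of at least \<open>1\<close>.
\<close>

lemma c_const_lower_bound:
  assumes "n \<ge> 1" "0 \<le> s0" "s0 < 1"
  shows "real n * (real n - 1 / 2) \<le> c_const n s0"
proof -
  define t where "t = s0 powr (1 / 2 ^ n)"
  have t: "0 \<le> t" "t < 1"
  proof -
    show "0 \<le> t" by (simp add: t_def)
    have "s0 powr (1 / 2 ^ n) < 1 powr (1 / 2 ^ n)" using assms by (intro powr_less_mono2) auto
    thus "t < 1" by (simp add: t_def)
  qed
  have "1 \<le> ((1 + t) / (1 - t)) ^ (n - 1)" using t by (intro one_le_power) (simp add: field_simps)
  moreover have "real n \<le> real n powr (3 / 2)"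
    using assms powr_mono[of 1 "3/2" "real n"] by simp
  ultimately have "(real n * (real n - 1 / 2)) * 1 \<le>
      (real n powr (3 / 2) * (real n - 1 / 2)) * ((1 + t) / (1 - t)) ^ (n - 1)"
    using assms by (intro mult_mono mult_nonneg_nonneg) auto
  thus ?thesis by (simp add: c_const_def t_def)
qed

theorem theorem1p1:
  fixes S :: "(real ^ 'n) set" and s s0 :: real
  assumes "well_centered S"
    and "0 \<le> s" and "s \<le> s0" and "s0 < 1"
  shows "\<forall>y \<in> dilate (1 - s) (frontier S).
           \<exists>P. supporting_hyperplane P S \<and>
               infdist y P \<le> c_const CARD('n) s0 * s powr (1 / 2 ^ (CARD('n) - 1))
                                * diameter (normal_line P \<inter> S)"
proof
  fix y assume "y \<in> dilate (1 - s) (frontier S)"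
  then obtain x where x: "x \<in> frontier S" and y: "y = (1 - s) *\<^sub>R x" by (auto simp: dilate_def)
  define n where "n = CARD('n)"
  have S: "compact S" "convex S" "interior S \<noteq> {}"
    using assms(1) by (auto simp: well_centered_def convex_body_def)
  obtain f :: "real ^ 'n \<Rightarrow> real ^ 'n" where f: "linear f" "bij f"
    and ES: "f ` cball 0 1 \<subseteq> S"
    and SE: "S \<subseteq> (\<lambda>a. real DIM(real ^ 'n) *\<^sub>R a) ` f ` cball 0 1"
    using assms(1) by (auto simp: well_centered_def centered_ellipsoid_def dilate_def)
  have n1: "1 \<le> n" by (simp add: n_def Suc_le_eq)
  have xS: "x \<in> S" using x S(1) by (simp add: frontier_def compact_imp_closed)
  have "0 \<in> f ` cball 0 1" using linear_0[OF f(1)] by (intro image_eqI[of _ _ 0]) auto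
  hence yS: "y \<in> S"
    using convexD[OF S(2) xS, of 0 "1 - s" s] ES assms by (auto simp: y)
  have "x \<notin> rel_interior S"
    using x S(3) by (simp add: frontier_def rel_interior_nonempty_interior)
  then obtain u where u: "u \<noteq> 0" "\<And>z. z \<in> S \<Longrightarrow> u \<bullet> x \<le> u \<bullet> z"
    using supporting_hyperplane_rel_boundary[OF S(2) xS] by metis
  show "\<exists>P. supporting_hyperplane P S \<and>
          infdist y P \<le> c_const CARD('n) s0 * s powr (1 / 2 ^ (CARD('n) - 1))
                           * diameter (normal_line P \<inter> S)"
  \<comment> \<open>For \<open>s = 0\<close> the power of \<open>s\<close> vanishes, and the hyperplane supporting \<open>S\<close> at \<open>y = x\<close>
    is at distance \<open>0\<close>. Otherwise \<open>\<sigma> > 0\<close>, as the selection of the cut needs.\<close>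
  proof (cases "s = 0")
    case True
    have "supporting_hyperplane {z. - u \<bullet> z = - u \<bullet> x} S"
      by (rule supporting_hyperplane_at_maximizer) (use u xS in auto)
    moreover have "infdist y {z. - u \<bullet> z = - u \<bullet> x} = 0" using True by (simp add: y)
    ultimately show ?thesis using True by (intro exI[of _ "{z. - u \<bullet> z = - u \<bullet> x}"]) simp
  next
    case False
    \<comment> \<open>In all dimensions \<open>n \<le> 2 ^ (n - 1)\<close>, so that this choice meets the requirement
      \<open>s \<le> \<sigma> ^ n\<close> of the tilting argument.\<close>
    define \<sigma> where "\<sigma> = s powr (1 / 2 ^ (n - 1))"
    have spos: "0 < s" "s \<le> 1" using False assms by auto
    have \<sigma>: "0 < \<sigma>" "\<sigma> \<le> 1" using spos by (auto simp: \<sigma>_def intro: powr_le1)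
    have "\<sigma> ^ 2 ^ (n - 1) = s" using spos by (simp add: \<sigma>_def powr_power)
    moreover have "n \<le> 2 ^ (n - 1)" using n1 less_exp[of "n - 1"] by linarith
    ultimately have s\<sigma>: "s \<le> \<sigma> ^ n" using power_decreasing[of n "2 ^ (n - 1)" \<sigma>] \<sigma> by auto
    obtain v r where v: "v \<noteq> 0" and r: "0 < r" and rE: "(r / norm v) *\<^sub>R v \<in> f ` cball 0 1"
      and gap: "\<And>z. z \<in> S \<Longrightarrow> v \<bullet> z - (1 - s) * (v \<bullet> x)
              \<le> real n * (2 * real n - 1) * \<sigma> * r * norm v"
      using good_direction_exists[OF f SE xS, of "- u" \<sigma> s] u \<sigma> s\<sigma> spos by (auto simp: n_def)
    obtain z where z: "z \<in> S" "\<And>z'. z' \<in> S \<Longrightarrow> v \<bullet> z' \<le> v \<bullet> z"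
      using continuous_attains_sup[OF S(1), of "\<lambda>z. v \<bullet> z"] xS continuous_on_inner[OF
          continuous_on_const[of S v] continuous_on_id] by auto
    define b where "b = v \<bullet> z"
    define P where "P = {p. v \<bullet> p = b}"
    have P: "supporting_hyperplane P S"
      unfolding P_def b_def using v z by (rule supporting_hyperplane_at_maximizer)
    define q where "q = (r / norm v) *\<^sub>R v"
    have q: "q \<in> S" "- q \<in> S"
    proof -
      show "q \<in> S" using rE ES by (auto simp: q_def)
      obtain p where p: "q = f p" "norm p \<le> 1" using rE by (auto simp: q_def)
      have "- q \<in> f ` cball 0 1"
        using p linear_neg[OF f(1), of p] by (intro image_eqI[of _ _ "- p"]) auto
      thus "- q \<in> S" using ES by auto
    qed
    have "q \<in> normal_line P" "- q \<in> normal_line P"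
      by (auto simp: normal_line_def P_def q_def inner_diff_right)
    hence "dist q (- q) \<le> diameter (normal_line P \<inter> S)"
      using q S(1) by (intro diameter_bounded_bound) (auto intro: bounded_Int compact_imp_bounded)
    moreover have "dist q (- q) = 2 * r"
    proof -
      have "dist q (- q) = norm (2 *\<^sub>R q)" by (simp add: dist_norm scaleR_2)
      thus ?thesis using v r by (simp add: q_def)
    qed
    ultimately have diam: "2 * r \<le> diameter (normal_line P \<inter> S)" by simp
    have "infdist y P \<le> (b - v \<bullet> y) / norm v"
      unfolding P_def using z(2)[OF yS] v by (intro infdist_hyperplane_le) (auto simp: b_def)
    also have "\<dots> \<le> real n * (2 * real n - 1) * \<sigma> * r"
      using gap[OF z(1)] v by (simp add: b_def y pos_divide_le_eq)
    also have "\<dots> = (real n * (real n - 1 / 2)) * \<sigma> * (2 * r)" by (simp add: algebra_simps)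
    also have "\<dots> \<le> c_const n s0 * \<sigma> * diameter (normal_line P \<inter> S)"
    proof (intro mult_mono diam)
      show low: "real n * (real n - 1 / 2) \<le> c_const n s0"
        using n1 assms by (intro c_const_lower_bound) auto
      have "0 \<le> real n * (real n - 1 / 2)" using n1 by (intro mult_nonneg_nonneg) auto
      thus "0 \<le> c_const n s0" "0 \<le> c_const n s0 * \<sigma>" using low \<sigma> by auto
    qed (use \<sigma> r in auto)
    finally show ?thesis using P by (auto simp: n_def \<sigma>_def)
  qed
qed

end
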